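(* For every even integer $q\ge 2$, $N(4,q,1)=\dfrac{q^2(q+2)}{4}$.
   Context: $B_q=\{0,\dots,q-1\}$ and $B_q^4$ is the set of words of length 4 over $B_q$. $N(4,q,1)$ is the maximum cardinality of a code $C\subseteq B_q^4$ capable of correcting single deletions, i.e. such that the sets $\lfloor x\rfloor_1$ ($x\in C$) of words obtained from $x$ by deleting one letter are pairwise disjoint (equivalently, the minimum deletion–insertion distance, i.e. minimum number of letter deletions and insertions transforming one codeword into another, between distinct codewords exceeds 2). *)

theory Defs
  imports Main
begin

definition words :: "nat \<Rightarrow> nat \<Rightarrow> nat list set" where
  "words n q = {xs. length xs = n \<and> set xs \<subseteq> {0..<q}}"

definition del1 :: "nat list \<Rightarrow> nat list set" where
  "del1 x = {take i x @ drop (Suc i) x | i. i < length x}"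

definition single_del_code :: "nat \<Rightarrow> nat \<Rightarrow> nat list set \<Rightarrow> bool" where
  "single_del_code n q C \<longleftrightarrow> C \<subseteq> words n q \<and>
     (\<forall>x\<in>C. \<forall>y\<in>C. x \<noteq> y \<longrightarrow> del1 x \<inter> del1 y = {})"

definition N1 :: "nat \<Rightarrow> nat \<Rightarrow> nat" where
  "N1 n q = Max {card C | C. single_del_code n q C}"

end

theory Submission
  imports Defs
begin

text \<open>
  Upper bound: weight the triples by \<open>aaa \<mapsto> 4\<close>, \<open>aab, abb \<mapsto> 2\<close>, \<open>aba \<mapsto> 0\<close>, \<open>abc \<mapsto> 1\<close>. The triples
  deleted from a word weigh at least 4 in total, except for words \<open>abca\<close> with \<open>a, b, c\<close> distinct,
  where they weigh 2. In a code the pairs \<open>{b, c}\<close> occurring in codewords \<open>abca\<close> with fixed \<open>a\<close> are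
  disjoint subsets of the remaining \<open>q - 1\<close> letters, and since \<open>q - 1\<close> is odd one letter stays
  unpaired.

  Lower bound: let \<open>q = 2h\<close> and compute with letters modulo \<open>q\<close>. Take all words \<open>(x, x, y, y)\<close>, the
  parallelograms \<open>(x, x \<plusminus> s, x \<plusminus> t, x \<plusminus> (s + t))\<close> with \<open>0 < t < s < h\<close>, and for \<open>0 < \<bar>p\<bar> < h/2\<close> the
  words \<open>(x, x + p + h, x + p, x + 2p)\<close> and \<open>(x, x + p, x + p + h, x)\<close>; if \<open>h\<close> is even, add a code
  on each coset of the subgroup of order 4. Parallelograms cover the triples whose two differences
  have distinct absolute values below \<open>h\<close>; the last two families cover those with a difference \<open>h\<close>,
  the arithmetic progressions and the triples \<open>aba\<close>.
\<close>

subsection \<open>Upper bound by weights\<close>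

lemma words_3_eq: "words 3 q = (\<lambda>(a,b,c). [a,b,c]) ` ({0..<q} \<times> {0..<q} \<times> {0..<q})"
  by (force simp: words_def numeral_3_eq_3 length_Suc_conv image_iff)

lemma words_4_cases:
  assumes "x \<in> words 4 q"
  obtains a b c d where "x = [a,b,c,d]" "a < q" "b < q" "c < q" "d < q"
  using assms by (auto simp: words_def numeral_eq_Suc length_Suc_conv)

lemma del1_4: "del1 [a,b,c,d] = {[b,c,d],[a,c,d],[a,b,d],[a,b,c]}"
proof -
  have "del1 [a,b,c,d] = (\<lambda>i. take i [a,b,c,d] @ drop (Suc i) [a,b,c,d]) ` {..<4}"
    by (auto simp: del1_def)
  also have "{..<4::nat} = {0, 1, 2, 3}" by auto
  finally show ?thesis by (simp add: numeral_eq_Suc)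
qed

lemma finite_words: "finite (words n q)"
  using finite_lists_length_eq[of "{0..<q}" n] by (simp add: words_def conj_commute)

fun triple_weight :: "nat list \<Rightarrow> nat" where
  "triple_weight [a,b,c] =
     (if a = b \<and> b = c then 4 else if a = b \<or> b = c then 2 else if a = c then 0 else 1)"
| "triple_weight _ = 0"

fun bracketed :: "nat list \<Rightarrow> bool" where
  "bracketed [a,b,c,d] \<longleftrightarrow> a = d \<and> a \<noteq> b \<and> a \<noteq> c \<and> b \<noteq> c"
| "bracketed _ \<longleftrightarrow> False"

lemma sum_triple_weight_del1:
  assumes "x \<in> words 4 q"
  shows "4 \<le> (\<Sum>y\<in>del1 x. triple_weight y) + (if bracketed x then 2 else 0)"
proof -
  obtain a b c d where x: "x = [a,b,c,d]" using assms by (rule words_4_cases)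
  show ?thesis
    unfolding x del1_4
    \<comment> \<open>Weights depend only on which letters coincide, so these six comparisons
      exhaust the cases. Coinciding triples count only once in \<open>del1 x\<close>.\<close>
    by (cases "a = b"; cases "a = c"; cases "a = d"; cases "b = c"; cases "b = d"; cases "c = d")
      auto
qed

text \<open>When \<open>a \<noteq> b\<close>, the weight 2 at \<open>c = b\<close> makes up for the
  weight 0 at \<open>c = a\<close>, and every other \<open>c\<close> weighs 1.\<close>

lemma sum_triple_weight_third:
  assumes "a < q" "b < q"
  shows "(\<Sum>c<q. triple_weight [a,b,c]) = (if a = b then 2 * q + 2 else q)"
proof (cases "a = b")
  case True
  have "(\<Sum>c<q. triple_weight [a,b,c]) = (\<Sum>c<q. 2 + (if c = a then 2 else 0))"
    using True by (intro sum.cong) auto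
  also have "\<dots> = 2 * q + 2" using assms by (simp only: sum.distrib) simp
  finally show ?thesis using True by simp
next
  case False
  have "(\<Sum>c<q. triple_weight [a,b,c]) + 1
      = (\<Sum>c<q. triple_weight [a,b,c] + (if c = a then 1 else 0))"
    using assms by (simp only: sum.distrib) simp
  also have "\<dots> = (\<Sum>c<q. 1 + (if c = b then 1 else 0))"
    using False by (intro sum.cong) auto
  also have "\<dots> = q + 1" using assms by (simp only: sum.distrib) simp
  finally show ?thesis using False by simp
qed

lemma sum_triple_weight_words: "(\<Sum>y\<in>words 3 q. triple_weight y) = q * (q^2 + q + 2)"
proof -
  have "(\<Sum>y\<in>words 3 q. triple_weight y)
      = (\<Sum>(a,b,c)\<in>{0..<q} \<times> {0..<q} \<times> {0..<q}. triple_weight [a,b,c])"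
    unfolding words_3_eq by (subst sum.reindex) (auto simp: inj_on_def case_prod_unfold)
  also have "\<dots> = (\<Sum>a<q. \<Sum>b<q. \<Sum>c<q. triple_weight [a,b,c])"
    by (simp add: sum.cartesian_product[symmetric] atLeast0LessThan)
  also have "\<dots> = (\<Sum>a<q. \<Sum>b<q. if a = b then 2 * q + 2 else q)"
    by (intro sum.cong refl) (use sum_triple_weight_third in auto)
  also have "\<dots> = (\<Sum>a<q. \<Sum>b<q. q + (if b = a then q + 2 else 0))"
    by (intro sum.cong refl) auto
  also have "\<dots> = q * (q^2 + q + 2)"
    by (simp add: sum.distrib power2_eq_square)
  finally show ?thesis .
qed

text \<open>The deletions of \<open>[a,b,c,a]\<close> include \<open>[a,b,a]\<close> and
  \<open>[a,c,a]\<close>, so two such codewords with a common inner letter would share a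
  triple.\<close>

lemma card_bracketed_le:
  assumes C: "single_del_code 4 q C" and q: "even q" and a: "a < q"
  shows "2 * card {x \<in> C. bracketed x \<and> hd x = a} \<le> q - 2"
proof -
  let ?A = "{x \<in> C. bracketed x \<and> hd x = a}"
  have CW: "C \<subseteq> words 4 q"
    and disj: "\<And>x y. x \<in> C \<Longrightarrow> y \<in> C \<Longrightarrow> x \<noteq> y \<Longrightarrow> del1 x \<inter> del1 y = {}"
    using C by (auto simp: single_del_code_def)
  have fin: "finite ?A" using CW finite_words finite_subset by fastforce
  have form: "\<exists>b c. x = [a,b,c,a] \<and> b \<noteq> c \<and> b \<noteq> a \<and> c \<noteq> a \<and> b < q \<and> c < q"
    if "x \<in> ?A" for x
  proof -
    have "x \<in> words 4 q" using that CW by auto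
    then show ?thesis using that by (elim words_4_cases) auto
  qed
  have card2: "card {x ! 1, x ! 2} = 2" if "x \<in> ?A" for x
    using form[OF that] by auto
  have dj: "{x ! 1, x ! 2} \<inter> {y ! 1, y ! 2} = {}" if "x \<in> ?A" "y \<in> ?A" "x \<noteq> y" for x y
  proof -
    obtain b c where x: "x = [a,b,c,a]" using form[OF \<open>x \<in> ?A\<close>] by auto
    obtain b' c' where y: "y = [a,b',c',a]" using form[OF \<open>y \<in> ?A\<close>] by auto
    have "del1 x \<inter> del1 y = {}" using disj that by auto
    then show ?thesis unfolding x y del1_4 by auto
  qed
  have "2 * card ?A = (\<Sum>x\<in>?A. card {x ! 1, x ! 2})"
    using card2 by simp
  also have "\<dots> = card (\<Union>x\<in>?A. {x ! 1, x ! 2})"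
    by (rule card_UN_disjoint[symmetric]) (use fin dj in auto)
  also have "\<dots> \<le> card ({0..<q} - {a})"
  proof (rule card_mono)
    have "{x ! 1, x ! 2} \<subseteq> {0..<q} - {a}" if "x \<in> ?A" for x
      using form[OF that] by auto
    then show "(\<Union>x\<in>?A. {x ! 1, x ! 2}) \<subseteq> {0..<q} - {a}" by blast
  qed simp
  also have "\<dots> = q - 1" using a by simp
  finally show ?thesis using q a by presburger
qed

text \<open>Disjointness bounds the total weight of the deleted triples by the weight of all
  triples; each bracketed codeword adds a deficit of at most 2.\<close>

lemma single_del_code_card_le:
  assumes C: "single_del_code 4 q C" and q: "even q" "q \<ge> 2"
  shows "4 * card C \<le> q^2 * (q + 2)"
proof -
  have CW: "C \<subseteq> words 4 q" and fin: "finite C"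
    using C finite_words finite_subset by (auto simp: single_del_code_def)
  have del: "del1 x \<subseteq> words 3 q" if "x \<in> C" for x
  proof -
    have "x \<in> words 4 q" using CW that by auto
    then obtain a b c d where "x = [a,b,c,d]" "a < q" "b < q" "c < q" "d < q"
      by (rule words_4_cases)
    then show ?thesis by (simp add: del1_4 words_def)
  qed
  have "(\<Sum>x\<in>C. \<Sum>y\<in>del1 x. triple_weight y) = (\<Sum>y\<in>(\<Union>x\<in>C. del1 x). triple_weight y)"
    using C fin finite_subset[OF del finite_words]
    by (intro sum.UNION_disjoint[symmetric]) (auto simp: single_del_code_def)
  also have "\<dots> \<le> (\<Sum>y\<in>words 3 q. triple_weight y)"
    using del by (intro sum_mono2 finite_words) auto
  finally have weight: "(\<Sum>x\<in>C. \<Sum>y\<in>del1 x. triple_weight y) \<le> q * (q^2 + q + 2)"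
    by (simp add: sum_triple_weight_words)
  have "hd x < q" if "x \<in> C" for x
    using subsetD[OF CW that] by (elim words_4_cases) simp
  then have "{x \<in> C. bracketed x} = (\<Union>a<q. {x \<in> C. bracketed x \<and> hd x = a})"
    by blast
  then have "card {x \<in> C. bracketed x} \<le> (\<Sum>a<q. card {x \<in> C. bracketed x \<and> hd x = a})"
    by (simp add: card_UN_le)
  then have "2 * card {x \<in> C. bracketed x} \<le> (\<Sum>a<q. 2 * card {x \<in> C. bracketed x \<and> hd x = a})"
    by (simp add: sum_distrib_left[symmetric])
  also have "\<dots> \<le> (\<Sum>a<q. q - 2)"
    by (intro sum_mono) (use card_bracketed_le[OF C q(1)] in auto)
  finally have br: "2 * card {x \<in> C. bracketed x} \<le> q * (q - 2)" by simp
  have "4 * card C = (\<Sum>x\<in>C. 4)" by simp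
  also have "\<dots> \<le> (\<Sum>x\<in>C. (\<Sum>y\<in>del1 x. triple_weight y) + (if bracketed x then 2 else 0))"
    by (intro sum_mono sum_triple_weight_del1[of _ q]) (use CW in auto)
  also have "\<dots> = (\<Sum>x\<in>C. \<Sum>y\<in>del1 x. triple_weight y) + 2 * card {x \<in> C. bracketed x}"
    using fin by (simp add: sum.distrib sum.If_cases Int_def)
  also have "\<dots> \<le> q * (q^2 + q + 2) + q * (q - 2)" using weight br by linarith
  also have "\<dots> = q^2 * (q + 2)"
    \<comment> \<open>Writing \<open>q = 2 + n\<close> removes the truncated difference
      \<open>q - 2\<close>.\<close>
    using q(2) by (auto simp: algebra_simps power2_eq_square dest!: le_Suc_ex)
  finally show ?thesis .
qed

subsection \<open>Translation-invariant words\<close>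

definition letter :: "int \<Rightarrow> int \<Rightarrow> nat" where
  "letter h z = nat (z mod (2 * h))"

text \<open>Translation changes only \<open>z\<close>. Deleting an outer letter drops an outer
  difference; deleting an inner letter adds two neighbouring differences.\<close>

definition diff_word :: "int \<Rightarrow> int \<Rightarrow> int \<times> int \<times> int \<Rightarrow> nat list" where
  "diff_word h z = (\<lambda>(d1, d2, d3).
     [letter h z, letter h (z + d1), letter h (z + d1 + d2), letter h (z + d1 + d2 + d3)])"

text \<open>The representative modulo \<open>2 * h\<close> in \<open>{-h<..h}\<close>; the shift by
  \<open>h - 1\<close> puts the self-opposite residue \<open>h\<close> at the positive end.\<close>

definition centred :: "int \<Rightarrow> int \<Rightarrow> int" where
  "centred h z = (z + h - 1) mod (2 * h) - (h - 1)"

text \<open>The centred representative of \<open>p + h\<close>, for \<open>0 < \<bar>p\<bar> < h\<close>.\<close>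

definition antipode :: "int \<Rightarrow> int \<Rightarrow> int" where
  "antipode h p = (if p < 0 then p + h else p - h)"

definition constant_types :: "int \<Rightarrow> (int \<times> int \<times> int) set" where
  "constant_types h = (\<lambda>d. (0, d, 0)) ` {-h<..h}"

text \<open>With \<open>t = s + d\<close>, the sign and size conditions say that \<open>t\<close>
  lies strictly between 0 and \<open>s\<close>.\<close>

definition parallelogram_types :: "int \<Rightarrow> (int \<times> int \<times> int) set" where
  "parallelogram_types h =
     {(s, d, s) | s d. (0 < s \<and> d < 0 \<or> s < 0 \<and> 0 < d) \<and> \<bar>d\<bar> < \<bar>s\<bar> \<and> \<bar>s\<bar> < h}"

text \<open>One element of each pair \<open>{p, p + h}\<close>, except that \<open>\<plusminus>h/2\<close> is left out when \<open>h\<close> is even.\<close>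

definition small :: "int \<Rightarrow> int set" where
  "small h = {p. p \<noteq> 0 \<and> 2 * \<bar>p\<bar> < h}"

text \<open>Deleting an inner letter leaves the arithmetic progressions with differences
  \<open>p\<close> and \<open>p + h\<close>.\<close>

definition progression_types :: "int \<Rightarrow> (int \<times> int \<times> int) set" where
  "progression_types h = (\<lambda>p. (antipode h p, h, p)) ` small h"

text \<open>Deleting an inner letter leaves triples \<open>aba\<close> whose first difference is
  \<open>p\<close> or \<open>p + h\<close> modulo \<open>2 * h\<close>.\<close>

definition bracket_types :: "int \<Rightarrow> (int \<times> int \<times> int) set" where
  "bracket_types h = (\<lambda>p. (p, h, - antipode h p)) ` small h"

definition cyclic_types :: "int \<Rightarrow> (int \<times> int \<times> int) set" where
  "cyclic_types h =
     constant_types h \<union> parallelogram_types h \<union> progression_types h \<union> bracket_types h"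

lemmas types_defs = cyclic_types_def constant_types_def parallelogram_types_def
  progression_types_def bracket_types_def small_def

definition cyclic_code :: "int \<Rightarrow> nat list set" where
  "cyclic_code h = (\<lambda>(z, t). diff_word h z t) ` ({0..<2 * h} \<times> cyclic_types h)"

text \<open>A triple with first letter \<open>z\<close> and centred differences \<open>u\<close>, \<open>v\<close> determines the
  codeword it was deleted from. The unequal absolute values below \<open>h\<close> belong to parallelograms:
  the larger difference is the side \<open>s\<close>, and the relative sign tells an inner from an outer
  deletion.\<close>

definition decode :: "int \<Rightarrow> int \<Rightarrow> int \<Rightarrow> int \<Rightarrow> nat list" where
  "decode h z u v =
    (if u = 0 then diff_word h z (0, v, 0)
     else if v = 0 then diff_word h z (0, u, 0)
     else if \<bar>u\<bar> \<noteq> \<bar>v\<bar> \<and> u \<noteq> h \<and> v \<noteq> h then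
       if \<bar>v\<bar> < \<bar>u\<bar> then diff_word h z (u, if 0 < u \<longleftrightarrow> 0 < v then v - u else v, u)
       else if 0 < u \<longleftrightarrow> 0 < v then diff_word h z (v, u - v, v)
       else diff_word h (z - v) (v, u, v)
     else if v = h then
       diff_word h z (u, h, if 2 * \<bar>u\<bar> < h then - antipode h u else antipode h u)
     else if u = h then
       if 2 * \<bar>v\<bar> < h then diff_word h (z - antipode h v) (antipode h v, h, v)
       else diff_word h (z + antipode h v) (- antipode h v, h, v)
     else if u = v then
       if 2 * \<bar>u\<bar> < h then diff_word h z (antipode h u, h, u)
       else diff_word h z (u, h, antipode h u)
     else
       if 2 * \<bar>u\<bar> < h then diff_word h z (u, h, - antipode h u)
       else diff_word h z (antipode h u, h, - u))"

section \<open>Unique decoding of the cyclic code\<close>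

lemma centred_eqI:
  assumes "-h < w" "w \<le> h" "z = w \<or> z = w + 2 * h \<or> z = w - 2 * h"
  shows "centred h z = w"
proof -
  have *: "(w + h - 1) mod (2 * h) = w + h - 1" using assms by simp
  from assms(3) consider "z + h - 1 = w + h - 1" | "z + h - 1 = (w + h - 1) + 2 * h"
    | "z + h - 1 = (w + h - 1) - 2 * h" by linarith
  then have "(z + h - 1) mod (2 * h) = (w + h - 1) mod (2 * h)"
    by cases (simp_all only: mod_add_self2 minus_mod_self2)
  then show ?thesis using * by (simp add: centred_def)
qed

text \<open>One equation for each deleted letter, from the fourth to the first. Of \<open>p\<close>
  and \<open>antipode h p\<close> only \<open>p\<close> is below \<open>h/2\<close> in absolute
  value, so the size tests in \<open>decode\<close> separate progressions from brackets.\<close>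

lemma decode_type:
  assumes "0 < h" "(d1, d2, d3) \<in> cyclic_types h"
  shows "decode h z (centred h d1) (centred h d2) = diff_word h z (d1, d2, d3)"
    and "decode h z (centred h d1) (centred h (d2 + d3)) = diff_word h z (d1, d2, d3)"
    and "decode h z (centred h (d1 + d2)) (centred h d3) = diff_word h z (d1, d2, d3)"
    and "decode h (z + d1) (centred h d2) (centred h d3) = diff_word h z (d1, d2, d3)"
proof -
  let ?w = "diff_word h z (d1, d2, d3)"
  consider "d1 = 0" "d3 = 0" "-h < d2" "d2 \<le> h"
    | "d1 = d3" "0 < d1 \<and> d2 < 0 \<or> d1 < 0 \<and> 0 < d2" "\<bar>d2\<bar> < \<bar>d1\<bar>" "\<bar>d1\<bar> < h"
    | "d1 = antipode h d3" "d2 = h" "d3 \<noteq> 0" "2 * \<bar>d3\<bar> < h"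
    | "d3 = - antipode h d1" "d2 = h" "d1 \<noteq> 0" "2 * \<bar>d1\<bar> < h"
    using assms(2) by (auto simp: types_defs)
  then have "decode h z (centred h d1) (centred h d2) = ?w
    \<and> decode h z (centred h d1) (centred h (d2 + d3)) = ?w
    \<and> decode h z (centred h (d1 + d2)) (centred h d3) = ?w
    \<and> decode h (z + d1) (centred h d2) (centred h d3) = ?w"
  proof cases
    case 1
    have c: "centred h d1 = 0" "centred h d2 = d2" "centred h d3 = 0"
      "centred h (d1 + d2) = d2" "centred h (d2 + d3) = d2"
      using 1 assms(1) by (auto intro!: centred_eqI)
    show ?thesis unfolding c using 1 by (simp add: decode_def)
  next
    case 2
    have c: "centred h d1 = d1" "centred h d2 = d2" "centred h d3 = d1"
      "centred h (d1 + d2) = d1 + d2" "centred h (d2 + d3) = d1 + d2"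
      using 2 by (auto intro!: centred_eqI)
    consider "0 < d1" "d2 < 0" "- d2 < d1" "d1 < h" | "d1 < 0" "0 < d2" "d2 < - d1" "- d1 < h"
      using 2 by linarith
    then show ?thesis
      unfolding c by cases (simp_all add: decode_def abs_if 2(1)[symmetric])
  next
    case 3
    consider "d3 < 0" "- 2 * d3 < h" | "0 < d3" "2 * d3 < h"
      using 3 by linarith
    then show ?thesis
    proof cases
      case 1
      have f: "antipode h d3 = d3 + h" "antipode h (d3 + h) = d3"
        using 1 by (auto simp: antipode_def)
      have c: "centred h d1 = d3 + h" "centred h d2 = h" "centred h d3 = d3"
        "centred h (d1 + d2) = d3" "centred h (d2 + d3) = d3 + h"
        using 1 3 by (auto intro!: centred_eqI simp: f)
      show ?thesis unfolding c using 3(1,2) 1 f by (simp add: decode_def abs_if)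
    next
      case 2
      have f: "antipode h d3 = d3 - h" "antipode h (d3 - h) = d3"
        using 2 by (auto simp: antipode_def)
      have c: "centred h d1 = d3 - h" "centred h d2 = h" "centred h d3 = d3"
        "centred h (d1 + d2) = d3" "centred h (d2 + d3) = d3 - h"
        using 2 3 by (auto intro!: centred_eqI simp: f)
      show ?thesis unfolding c using 3(1,2) 2 f by (simp add: decode_def abs_if)
    qed
  next
    case 4
    consider "d1 < 0" "- 2 * d1 < h" | "0 < d1" "2 * d1 < h"
      using 4 by linarith
    then show ?thesis
    proof cases
      case 1
      have f: "antipode h d1 = d1 + h" "antipode h (d1 + h) = d1" "antipode h (- (d1 + h)) = - d1"
        using 1 by (auto simp: antipode_def)
      have c: "centred h d1 = d1" "centred h d2 = h" "centred h d3 = - (d1 + h)"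
        "centred h (d1 + d2) = d1 + h" "centred h (d2 + d3) = - d1"
        using 1 4 by (auto intro!: centred_eqI simp: f)
      show ?thesis unfolding c using 4(1,2) 1 f by (simp add: decode_def abs_if)
    next
      case 2
      have f: "antipode h d1 = d1 - h" "antipode h (d1 - h) = d1" "antipode h (- (d1 - h)) = - d1"
        using 2 by (auto simp: antipode_def)
      have c: "centred h d1 = d1" "centred h d2 = h" "centred h d3 = - (d1 - h)"
        "centred h (d1 + d2) = d1 - h" "centred h (d2 + d3) = - d1"
        using 2 4 by (auto intro!: centred_eqI simp: f)
      show ?thesis unfolding c using 4(1,2) 2 f by (simp add: decode_def abs_if)
    qed
  qed
  then show "decode h z (centred h d1) (centred h d2) = ?w"
    and "decode h z (centred h d1) (centred h (d2 + d3)) = ?w"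
    and "decode h z (centred h (d1 + d2)) (centred h d3) = ?w"
    and "decode h (z + d1) (centred h d2) (centred h d3) = ?w"
    by simp_all
qed

lemma letter_cong: "x mod (2 * h) = y mod (2 * h) \<Longrightarrow> letter h (x + d) = letter h (y + d)"
  by (metis letter_def mod_add_left_eq)

lemma diff_word_cong:
  assumes "x mod (2 * h) = y mod (2 * h)"
  shows "diff_word h (x + d) t = diff_word h (y + d) t"
  using letter_cong[OF assms]
  by (auto simp: diff_word_def add.assoc split: prod.split)

lemma decode_cong:
  assumes "x mod (2 * h) = y mod (2 * h)"
  shows "decode h x u v = decode h y u v"
proof -
  have "diff_word h (x - d) t = diff_word h (y - d) t" for d t
    using diff_word_cong[OF assms, of "- d"] by simp
  moreover have "diff_word h x t = diff_word h y t" for t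
    using diff_word_cong[OF assms, of 0] by simp
  ultimately show ?thesis
    using diff_word_cong[OF assms] by (simp only: decode_def)
qed

text \<open>\<open>decode\<close> depends on its first argument, and \<open>centred\<close> on its
  own, only modulo \<open>2 * h\<close>. Hence reduced letters may be replaced by the integers
  behind them.\<close>

lemma decode_letters:
  assumes "0 < h"
  shows "decode h (int (letter h x)) (centred h (int (letter h y) - int (letter h x)))
      (centred h (int (letter h z) - int (letter h y)))
    = decode h x (centred h (y - x)) (centred h (z - y))"
proof -
  have "centred h a = centred h b" if "a mod (2 * h) = b mod (2 * h)" for a b
    unfolding centred_def add_diff_eq[symmetric] using mod_add_cong[OF that refl] by simp
  then have c: "centred h (a mod (2 * h) - b mod (2 * h)) = centred h (a - b)" for a b
    using mod_diff_eq by blast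
  have l: "int (letter h a) = a mod (2 * h)" for a using assms by (simp add: letter_def)
  show ?thesis unfolding l c by (rule decode_cong) simp
qed

lemma decode_del1:
  assumes h: "0 < h" and x: "x \<in> cyclic_code h" and y: "[a, b, c] \<in> del1 x"
  shows "decode h (int a) (centred h (int b - int a)) (centred h (int c - int b)) = x"
proof -
  obtain z d1 d2 d3 where t: "(d1, d2, d3) \<in> cyclic_types h" and x: "x = diff_word h z (d1, d2, d3)"
    using x by (auto simp: cyclic_code_def)
  have "z + d1 - z = d1" "z + d1 + d2 - z = d1 + d2" "z + d1 + d2 - (z + d1) = d2"
    "z + d1 + d2 + d3 - (z + d1) = d2 + d3" "z + d1 + d2 + d3 - (z + d1 + d2) = d3"
    by simp_all
  note dec = decode_letters[OF h, of z "z + d1" "z + d1 + d2", unfolded this]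
    decode_letters[OF h, of z "z + d1" "z + d1 + d2 + d3", unfolded this]
    decode_letters[OF h, of z "z + d1 + d2" "z + d1 + d2 + d3", unfolded this]
    decode_letters[OF h, of "z + d1" "z + d1 + d2" "z + d1 + d2 + d3", unfolded this]
  from y show ?thesis
    unfolding x diff_word_def[of h z] prod.case del1_4
    by (elim insertE emptyE; simp only: list.inject dec decode_type[OF h t])
      (simp_all add: diff_word_def)
qed

lemma cyclic_code_disjoint:
  assumes "0 < h" "x \<in> cyclic_code h" "y \<in> cyclic_code h" "x \<noteq> y"
  shows "del1 x \<inter> del1 y = {}"
proof -
  have "\<exists>a b c. t = [a, b, c]" if "t \<in> del1 x" for t
    using that assms(2) by (auto simp: cyclic_code_def diff_word_def del1_4)
  then show ?thesis using decode_del1[OF assms(1)] assms by (metis disjoint_iff)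
qed

section \<open>Alphabet and size of the cyclic code\<close>

lemma letter_less: "0 < h \<Longrightarrow> letter h z < nat (2 * h)"
  by (simp add: letter_def)

lemma cyclic_code_subset_words: "0 < h \<Longrightarrow> cyclic_code h \<subseteq> words 4 (nat (2 * h))"
  using letter_less[of h] by (auto simp: cyclic_code_def diff_word_def words_def)

lemma letter_eq_iff: "0 < h \<Longrightarrow> letter h x = letter h y \<longleftrightarrow> 2 * h dvd x - y"
  by (simp add: letter_def eq_nat_nat_iff mod_eq_dvd_iff)

lemma letter_eqD:
  assumes "letter h x = letter h y" "0 < h" "\<bar>x - y\<bar> < 2 * h"
  shows "x = y"
  using assms dvd_imp_le_int[of "x - y" "2 * h"] by (fastforce simp: letter_eq_iff)

lemma cyclic_types_bounds:
  assumes "0 < h" "(d1, d2, d3) \<in> cyclic_types h"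
  shows "-h < d1" "d1 \<le> h" "-h < d2" "d2 \<le> h" "-h < d3" "d3 \<le> h"
  using assms by (auto simp: types_defs antipode_def)

text \<open>Read from the left, equal letters fix \<open>z\<close> and then each difference, since
  all differences lie in \<open>{-h<..h}\<close>, a window of one period.\<close>

lemma inj_on_diff_word:
  assumes "0 < h"
  shows "inj_on (\<lambda>(z, t). diff_word h z t) ({0..<2 * h} \<times> cyclic_types h)"
proof (rule inj_onI, simp only: split_paired_all mem_Times_iff fst_conv snd_conv prod.case
    prod.inject, elim conjE)
  fix z d1 d2 d3 z' e1 e2 e3 :: int
  assume z: "z \<in> {0..<2 * h}" "z' \<in> {0..<2 * h}"
    and t: "(d1, d2, d3) \<in> cyclic_types h" "(e1, e2, e3) \<in> cyclic_types h"
    and eq: "diff_word h z (d1, d2, d3) = diff_word h z' (e1, e2, e3)"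
  note b = cyclic_types_bounds[OF assms t(1)] cyclic_types_bounds[OF assms t(2)]
  have l: "letter h z = letter h z'" "letter h (z + d1) = letter h (z' + e1)"
    "letter h (z + d1 + d2) = letter h (z' + e1 + e2)"
    "letter h (z + d1 + d2 + d3) = letter h (z' + e1 + e2 + e3)"
    using eq by (simp_all add: diff_word_def)
  have 0: "z = z'" using letter_eqD[OF l(1) assms] z by auto
  have 1: "d1 = e1" using letter_eqD[OF l(2) assms] 0 b by auto
  have 2: "d2 = e2" using letter_eqD[OF l(3) assms] 0 1 b by auto
  have 3: "d3 = e3" using letter_eqD[OF l(4) assms] 0 1 2 b by auto
  show "z = z' \<and> d1 = e1 \<and> d2 = e2 \<and> d3 = e3" using 0 1 2 3 by simp
qed

lemma small_eq: "0 < h \<Longrightarrow> small h = {- ((h - 1) div 2)..(h - 1) div 2} - {0}"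
  by (auto simp: small_def)

lemma card_small:
  assumes "0 < h"
  shows "finite (small h)" "int (card (small h)) = 2 * ((h - 1) div 2)"
proof -
  show "finite (small h)" using assms by (simp add: small_eq)
  have "card (small h) = nat (2 * ((h - 1) div 2) + 1) - 1" using assms by (simp add: small_eq)
  moreover have "0 \<le> (h - 1) div 2" using assms by simp
  ultimately show "int (card (small h)) = 2 * ((h - 1) div 2)" by linarith
qed

text \<open>For an off-diagonal pair \<open>(i, j)\<close> the larger entry is
  \<open>\<bar>s\<bar>\<close>, the smaller one \<open>\<bar>s + d\<bar>\<close>, and the order of
  the entries gives the sign of \<open>s\<close>. This makes counting immediate.\<close>

lemma parallelogram_types_eq:
  "parallelogram_types h = (\<lambda>(i, j). (if j < i then i else - j, j - i, if j < i then i else - j))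
     ` ({0<..<h} \<times> {0<..<h} - (\<lambda>i. (i, i)) ` {0<..<h})" (is "_ = ?f ` ?I")
proof
  show "?f ` ?I \<subseteq> parallelogram_types h"
  proof clarify
    fix i j assume "i \<in> {0<..<h}" "j \<in> {0<..<h}" "(i, j) \<notin> (\<lambda>i. (i, i)) ` {0<..<h}"
    then show "(if j < i then i else - j, j - i, if j < i then i else - j) \<in> parallelogram_types h"
      by (cases i j rule: linorder_cases) (auto simp: parallelogram_types_def)
  qed
  show "parallelogram_types h \<subseteq> ?f ` ?I"
  proof
    fix t assume "t \<in> parallelogram_types h"
    then obtain s d where t: "t = (s, d, s)" and
      c: "0 < s \<and> d < 0 \<or> s < 0 \<and> 0 < d" "\<bar>d\<bar> < \<bar>s\<bar>" "\<bar>s\<bar> < h"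
      by (auto simp: parallelogram_types_def)
    define ij where "ij = (if 0 < s then (s, s + d) else (- s - d, - s))"
    have "ij \<in> ?I" "t = ?f ij" using c by (auto simp: t ij_def)
    then show "t \<in> ?f ` ?I" by blast
  qed
qed

lemma card_parallelogram_types:
  assumes "0 < h"
  shows "finite (parallelogram_types h)" "int (card (parallelogram_types h)) = (h - 1) * (h - 2)"
proof -
  let ?I = "{0<..<h} \<times> {0<..<h} - (\<lambda>i. (i, i)) ` {0<..<h}"
  let ?n = "nat (h - 1)"
  show "finite (parallelogram_types h)" by (simp add: parallelogram_types_eq)
  have "card (parallelogram_types h) = card ?I"
    unfolding parallelogram_types_eq
    by (rule card_image) (auto simp: inj_on_def split: if_splits)
  also have "\<dots> = card ({0<..<h} \<times> {0<..<h}) - card ((\<lambda>i. (i, i)) ` {0<..<h})"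
    by (rule card_Diff_subset) auto
  also have "\<dots> = ?n * ?n - ?n"
    by (simp add: card_cartesian_product card_image inj_on_def)
  finally have "card (parallelogram_types h) + ?n = ?n * ?n"
    by (cases ?n) simp_all
  then have "int (card (parallelogram_types h)) + int ?n = int ?n * int ?n"
    by (metis of_nat_add of_nat_mult)
  then show "int (card (parallelogram_types h)) = (h - 1) * (h - 2)"
    using assms by (simp add: algebra_simps)
qed

lemma card_cyclic_types:
  assumes "0 < h"
  shows "finite (cyclic_types h)"
    "int (card (cyclic_types h)) = 2 * h + (h - 1) * (h - 2) + 4 * ((h - 1) div 2)"
proof -
  let ?A = "constant_types h" and ?B = "parallelogram_types h"
    and ?C = "progression_types h" and ?D = "bracket_types h"
  have fin: "finite ?A" "finite ?B" "finite ?C" "finite ?D"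
    using card_small(1)[OF assms] card_parallelogram_types(1)[OF assms]
    by (simp_all add: constant_types_def progression_types_def bracket_types_def)
  then show "finite (cyclic_types h)" by (simp add: cyclic_types_def)
  \<comment> \<open>Only constant types have outer differences 0; among the others, only
    parallelograms have middle difference other than \<open>h\<close>. Progressions end in a
    difference below \<open>h/2\<close> in absolute value, brackets in one above it.\<close>
  have disj: "(?A \<union> ?B \<union> ?C) \<inter> ?D = {}" "(?A \<union> ?B) \<inter> ?C = {}" "?A \<inter> ?B = {}"
    by (auto simp: types_defs antipode_def split: if_splits)
  have A: "int (card ?A) = 2 * h"
    using assms by (simp add: constant_types_def card_image inj_on_def)
  have C: "int (card ?C) = 2 * ((h - 1) div 2)" and D: "int (card ?D) = 2 * ((h - 1) div 2)"
    using card_small(2)[OF assms]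
    by (simp_all add: progression_types_def bracket_types_def card_image inj_on_def)
  have "card (cyclic_types h) = card ?A + card ?B + card ?C + card ?D"
    using fin disj by (simp add: cyclic_types_def card_Un_disjoint)
  then show "int (card (cyclic_types h)) = 2 * h + (h - 1) * (h - 2) + 4 * ((h - 1) div 2)"
    using A C D card_parallelogram_types(2)[OF assms] by simp
qed

lemma card_cyclic_code:
  assumes "0 < h"
  shows "int (card (cyclic_code h)) = 2 * h * (2 * h + (h - 1) * (h - 2) + 4 * ((h - 1) div 2))"
  using assms inj_on_diff_word[OF assms] card_cyclic_types[OF assms]
  by (simp add: cyclic_code_def card_image card_cartesian_product)

text \<open>For \<open>h = 2k\<close> the differences \<open>\<plusminus>k\<close> are antipodes of each other, so the words with middle
  difference \<open>h\<close> would collide. The triples inside the cosets of \<open>{0, k, 2k, 3k}\<close> are covered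
  instead by copies of an optimal code on four letters, found by computer search.\<close>

definition quaternary_code :: "nat list set" where
  "quaternary_code = {[0,1,3,2], [0,3,1,0], [1,0,2,1], [1,2,3,0],
                      [2,1,0,3], [2,3,1,2], [3,0,2,3], [3,2,0,1]}"

definition coset_word :: "nat \<Rightarrow> nat \<Rightarrow> nat list \<Rightarrow> nat list" where
  "coset_word k r w = map (\<lambda>j. r + k * j) w"

definition coset_code :: "nat \<Rightarrow> nat list set" where
  "coset_code k = (\<lambda>(r, w). coset_word k r w) ` ({..<k} \<times> quaternary_code)"

lemma quaternary_code_disjoint:
  "w \<in> quaternary_code \<Longrightarrow> w' \<in> quaternary_code \<Longrightarrow> w \<noteq> w' \<Longrightarrow> del1 w \<inter> del1 w' = {}"
  unfolding quaternary_code_def by (elim insertE emptyE) (simp_all add: del1_4)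

text \<open>The five inequalities say that neighbouring letters differ in every deleted triple;
  \<open>a = d\<close> does occur, as in \<open>[0,3,1,0]\<close>.\<close>

lemma quaternary_code_cases:
  assumes "w \<in> quaternary_code"
  obtains a b c d where "w = [a,b,c,d]" "a < 4" "b < 4" "c < 4" "d < 4"
    "a \<noteq> b" "a \<noteq> c" "b \<noteq> c" "b \<noteq> d" "c \<noteq> d"
  using assms unfolding quaternary_code_def by (elim insertE emptyE) auto

lemma del1_coset_word:
  assumes "w \<in> quaternary_code"
  shows "del1 (coset_word k r w) = coset_word k r ` del1 w"
  by (rule quaternary_code_cases[OF assms]) (simp add: del1_4 coset_word_def)

lemma coset_word_eqD:
  assumes "coset_word k r w = coset_word k r' w'" "w \<noteq> []" "r < k" "r' < k"
  shows "r = r' \<and> w = w'"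
proof -
  obtain j js where w: "w = j # js" using assms(2) by (cases w) auto
  then obtain j' js' where w': "w' = j' # js'" using assms(1) by (cases w') (auto simp: coset_word_def)
  have "r + k * j = r' + k * j'" using assms(1) by (simp add: w w' coset_word_def)
  \<comment> \<open>The first letter modulo \<open>k\<close> reveals the coset.\<close>
  then have "(r + k * j) mod k = (r' + k * j') mod k" by simp
  then have r: "r = r'" using assms by simp
  have "inj (\<lambda>j. r + k * j)" using assms by (auto simp: inj_on_def)
  then show ?thesis using assms(1) r by (auto simp: coset_word_def inj_map_eq_map)
qed

lemma coset_code_disjoint:
  assumes "x \<in> coset_code k" "y \<in> coset_code k" "x \<noteq> y"
  shows "del1 x \<inter> del1 y = {}"
proof (rule ccontr)
  obtain r w r' w' where x: "x = coset_word k r w" "r < k" "w \<in> quaternary_code"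
    and y: "y = coset_word k r' w'" "r' < k" "w' \<in> quaternary_code"
    using assms by (auto simp: coset_code_def)
  assume "del1 x \<inter> del1 y \<noteq> {}"
  then obtain t t' where t: "t \<in> del1 w" "t' \<in> del1 w'" "coset_word k r t = coset_word k r' t'"
    unfolding x(1) y(1) del1_coset_word[OF x(3)] del1_coset_word[OF y(3)] by auto
  have "t \<noteq> []" using t(1) x(3) by (auto elim!: quaternary_code_cases simp: del1_4)
  then have "r = r'" "t = t'" using coset_word_eqD[OF t(3) _ x(2) y(2)] by auto
  then have "w = w'" using quaternary_code_disjoint[OF x(3) y(3)] t by auto
  then show False using assms(3) x y \<open>r = r'\<close> by simp
qed

lemma coset_code_subset_words: "coset_code k \<subseteq> words 4 (4 * k)"
proof -
  have "r + k * j < 4 * k" if "r < k" "j < 4" for r j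
  proof -
    have "r + k * j < k * Suc j" using that by simp
    also have "\<dots> \<le> k * 4" using that by (intro mult_le_mono2) simp
    finally show ?thesis by simp
  qed
  then show ?thesis
    by (auto simp: coset_code_def coset_word_def words_def elim!: quaternary_code_cases)
qed

lemma card_coset_code: "card (coset_code k) = 8 * k"
proof -
  have "inj_on (\<lambda>(r, w). coset_word k r w) ({..<k} \<times> quaternary_code)"
  proof (rule inj_onI, clarify)
    fix r w r' w' assume "r < k" "w \<in> quaternary_code" "r' < k"
      "coset_word k r w = coset_word k r' w'"
    then show "r = r' \<and> w = w'"
      using coset_word_eqD quaternary_code_cases by blast
  qed
  moreover have "card quaternary_code = 8" by (simp add: quaternary_code_def)
  ultimately show ?thesis by (simp add: coset_code_def card_image card_cartesian_product)
qed

section \<open>Separating the cyclic code from the coset code\<close>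

lemma coset_code_triple:
  assumes "x \<in> coset_code k" "[a, b, c] \<in> del1 x"
  shows "a mod k = b mod k" "b mod k = c mod k" "a \<noteq> b" "b \<noteq> c"
proof -
  obtain r w where x: "x = coset_word k r w" "r < k" "w \<in> quaternary_code"
    using assms(1) by (auto simp: coset_code_def)
  obtain t where t: "t \<in> del1 w" "[a, b, c] = coset_word k r t"
    using assms(2) unfolding x(1) del1_coset_word[OF x(3)] by auto
  obtain a' b' c' where t': "t = [a', b', c']" "a' \<noteq> b'" "b' \<noteq> c'"
    using t(1) x(3) by (auto elim!: quaternary_code_cases simp: del1_4)
  show "a mod k = b mod k" "b mod k = c mod k" "a \<noteq> b" "b \<noteq> c"
    using t(2) t' x(2) by (auto simp: coset_word_def)
qed

text \<open>In progressions and brackets \<open>k\<close> would divide \<open>p\<close> with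
  \<open>0 < \<bar>p\<bar> < k\<close>; this is where leaving out \<open>\<plusminus>h/2\<close>
  matters. Only constant types remain, and their triples have a zero difference.\<close>

lemma cyclic_types_not_coset:
  assumes k: "0 < k" and t: "(d1, d2, d3) \<in> cyclic_types (2 * k)"
    and uv: "(u, v) \<in> {(d1, d2), (d1, d2 + d3), (d1 + d2, d3), (d2, d3)}"
    and dvd: "k dvd u" "k dvd v"
  shows "u = 0 \<or> v = 0"
proof -
  have no_small: "p = 0" if "k dvd p" "\<bar>p\<bar> < k" for p
  proof (rule ccontr)
    assume "p \<noteq> 0"
    then show False using dvd_imp_le_int[OF _ that(1)] that(2) by linarith
  qed
  consider "d1 = 0" "d3 = 0"
    | "d1 = d3" "0 < d1 \<and> d2 < 0 \<or> d1 < 0 \<and> 0 < d2" "\<bar>d2\<bar> < \<bar>d1\<bar>" "\<bar>d1\<bar> < 2 * k"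
    | "d1 = antipode (2 * k) d3" "d2 = 2 * k" "d3 \<noteq> 0" "\<bar>d3\<bar> < k"
    | "d3 = - antipode (2 * k) d1" "d2 = 2 * k" "d1 \<noteq> 0" "\<bar>d1\<bar> < k"
    using t by (auto simp: types_defs)
  then show ?thesis
  proof cases
    case 1
    then show ?thesis using uv by auto
  next
    case 2
    have d: "k dvd d1" "k dvd d2"
      using uv dvd 2(1) by (auto simp: dvd_add_left_iff dvd_add_right_iff)
    have "k dvd d1 + d2" "k dvd d1 - k" "k dvd d1 + k" using d by auto
    \<comment> \<open>Since \<open>0 < \<bar>d1\<bar> < 2 * k\<close>, divisibility forces
      \<open>\<bar>d1\<bar> = k\<close>; then \<open>\<bar>d2\<bar> < k\<close> forces
      \<open>d2 = 0\<close>, a contradiction.\<close>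
    then show ?thesis
      using no_small[of "d2"] no_small[of "d1 - k"] no_small[of "d1 + k"] no_small[of "d1 + d2"] d 2 k
      by linarith
  next
    case 3
    have "k dvd d3" using uv dvd 3(1,2)
      by (auto simp: antipode_def dvd_add_left_iff dvd_add_right_iff dvd_diff_left_iff
          dvd_diff_right_iff split: if_splits)
    then show ?thesis using no_small 3 by auto
  next
    case 4
    have "k dvd d1" using uv dvd 4(1,2)
      by (auto simp: antipode_def dvd_add_left_iff dvd_add_right_iff dvd_diff_left_iff
          dvd_diff_right_iff split: if_splits)
    then show ?thesis using no_small 4 by auto
  qed
qed

lemma letter_mod_eqD:
  assumes "0 < k" "letter (2 * int k) x mod k = letter (2 * int k) y mod k"
  shows "int k dvd x - y"
proof -
  have "int (letter (2 * int k) z) mod int k = z mod int k" for z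
    using assms(1) by (simp add: letter_def mod_mod_cancel)
  then show ?thesis using assms(2) by (metis mod_eq_dvd_iff of_nat_mod)
qed

text \<open>A common triple would have both differences divisible by \<open>k\<close>, hence two
  equal neighbouring letters, which no triple of the coset code has.\<close>

lemma cyclic_coset_disjoint:
  assumes k: "0 < k" and x: "x \<in> cyclic_code (2 * int k)" and y: "y \<in> coset_code k"
  shows "del1 x \<inter> del1 y = {}"
proof (rule ccontr)
  let ?L = "letter (2 * int k)"
  assume "del1 x \<inter> del1 y \<noteq> {}"
  then obtain l where l: "l \<in> del1 x" "l \<in> del1 y" by auto
  obtain z d1 d2 d3 where t: "(d1, d2, d3) \<in> cyclic_types (2 * int k)"
    and x: "x = diff_word (2 * int k) z (d1, d2, d3)"
    using x by (auto simp: cyclic_code_def)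
  obtain a b c where abc: "l = [?L a, ?L b, ?L c]"
    "(b - a, c - b) \<in> {(d1, d2), (d1, d2 + d3), (d1 + d2, d3), (d2, d3)}"
    using l(1) unfolding x diff_word_def prod.case del1_4
    by (elim insertE emptyE) (force simp: algebra_simps)+
  note tr = coset_code_triple[OF y, of "?L a" "?L b" "?L c"]
  have "int k dvd b - a" "int k dvd c - b"
    using tr l(2) abc(1) letter_mod_eqD[OF k] by (metis dvd_diff_commute)+
  then have "b - a = 0 \<or> c - b = 0"
    using cyclic_types_not_coset[OF _ t abc(2)] k by simp
  then show False using tr(3,4) l(2) abc(1) by auto
qed

section \<open>The optimal code and the maximum\<close>

lemma exists_optimal_code:
  assumes "0 < h"
  shows "\<exists>C. single_del_code 4 (2 * h) C \<and> card C = 2 * h^2 * (h + 1)"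
proof (cases "even h")
  case False
  then obtain m where h: "h = 2 * m + 1" by (elim oddE)
  have "single_del_code 4 (2 * h) (cyclic_code (int h))"
    using cyclic_code_subset_words[of "int h"] cyclic_code_disjoint[of "int h"] assms
    by (auto simp: single_del_code_def nat_mult_distrib)
  \<comment> \<open>For odd \<open>h\<close> the halving is exact:
    \<open>2h + (h-1)(h-2) + 2(h-1) = h(h+1)\<close> types, each with \<open>2h\<close>
    translates.\<close>
  moreover have "int (card (cyclic_code (int h))) = int (2 * h^2 * (h + 1))"
    using card_cyclic_code[of "int h"] by (simp add: h power2_eq_square algebra_simps)
  then have "card (cyclic_code (int h)) = 2 * h^2 * (h + 1)" by linarith
  ultimately show ?thesis by blast
next
  case True
  then obtain k where h: "h = 2 * k" by (elim evenE)
  have k: "0 < k" using assms h by simp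
  let ?A = "cyclic_code (2 * int k)" and ?B = "coset_code k"
  have sub: "?A \<subseteq> words 4 (2 * h)" "?B \<subseteq> words 4 (2 * h)"
    using cyclic_code_subset_words[of "2 * int k"] coset_code_subset_words[of k] k
    by (simp_all add: h nat_mult_distrib)
  have code: "single_del_code 4 (2 * h) (?A \<union> ?B)"
    unfolding single_del_code_def
  proof (intro conjI ballI impI)
    show "?A \<union> ?B \<subseteq> words 4 (2 * h)" using sub by simp
    fix x y assume "x \<in> ?A \<union> ?B" "y \<in> ?A \<union> ?B" "x \<noteq> y"
    then show "del1 x \<inter> del1 y = {}"
      using cyclic_code_disjoint[of "2 * int k" x y] coset_code_disjoint[of x k y]
        cyclic_coset_disjoint[OF k, of x y] cyclic_coset_disjoint[OF k, of y x] k
      by (auto simp: Int_commute)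
  qed
  have "?A \<inter> ?B = {}"
  proof -
    \<comment> \<open>A word in both codes would make its own nonempty deletion set disjoint from
      itself.\<close>
    have "del1 x \<noteq> {}" if "x \<in> ?A" for x
      using that by (auto simp: cyclic_code_def diff_word_def del1_4)
    then show ?thesis using cyclic_coset_disjoint[OF k] by blast
  qed
  then have "card (?A \<union> ?B) = card ?A + card ?B"
    using sub finite_subset[OF _ finite_words] by (intro card_Un_disjoint) auto
  \<comment> \<open>For even \<open>h\<close> the rounding loses 2 types, that is
    \<open>4h = 8k\<close> words, exactly the size of the coset code.\<close>
  moreover have "(2 * int k - 1) div 2 = int k - 1" by simp
  then have "int (card ?A) = 2 * (2 * int k)
      * (2 * (2 * int k) + (2 * int k - 1) * (2 * int k - 2) + 4 * (int k - 1))"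
    using card_cyclic_code[of "2 * int k"] k by simp
  ultimately have "int (card (?A \<union> ?B)) = int (2 * h^2 * (h + 1))"
    by (simp add: card_coset_code h power2_eq_square algebra_simps)
  then have "card (?A \<union> ?B) = 2 * h^2 * (h + 1)" by linarith
  then show ?thesis using code by blast
qed

theorem theorem4p4:
  fixes q :: nat
  assumes "even q" and "q \<ge> 2"
  shows "N1 4 q = q^2 * (q + 2) div 4"
proof -
  obtain h where h: "q = 2 * h" using assms(1) by (elim evenE)
  \<comment> \<open>The factor 4 makes the division in the claim exact.\<close>
  have val: "q^2 * (q + 2) = 4 * (2 * h^2 * (h + 1))"
    by (simp add: h power2_eq_square algebra_simps)
  have upper: "card C \<le> 2 * h^2 * (h + 1)" if "single_del_code 4 q C" for C
    using single_del_code_card_le[OF that assms] val by simp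
  obtain C where C: "single_del_code 4 q C" "card C = 2 * h^2 * (h + 1)"
    using exists_optimal_code[of h] assms(2) h by auto
  have "Max {card C | C. single_del_code 4 q C} = 2 * h^2 * (h + 1)"
  proof (intro Max_eqI)
    show "finite {card C | C. single_del_code 4 q C}"
      using upper by (intro finite_subset[OF _ finite_atMost[of "2 * h^2 * (h + 1)"]]) auto
    show "2 * h^2 * (h + 1) \<in> {card C | C. single_del_code 4 q C}"
      using C by (metis (mono_tags, lifting) mem_Collect_eq)
  qed (use upper in auto)
  then show ?thesis unfolding N1_def val by simp
qed

end
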